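(* Fix $\widetilde z\in\mathbb{R}^n$ and consider the problem $$\min_{(w;u;v)\in\mathbb{R}^p\times\mathbb{R}^n\times\mathbb{R}^p}\ \mathcal{V}_{\rho,\mu}(w,u,\widetilde z,v).\qquad (\mathrm{E})$$ The following assertions hold. (i) Let $(\widehat w;\widehat u;\widehat v)\in\mathbb{R}^p\times\mathbb{R}^n\times\mathbb{R}^p$. If $(\widehat w;\widehat u;\widehat v)$ is a local minimizer of (E), then $(\widehat w;\widehat u;\widehat v)$ is a $\widetilde{\rm P}$-stationary point of (E) with a $\widetilde{\rm P}$-stationary multiplier $\widehat z$ and constant $\alpha$, for any $0<\alpha<\widehat\alpha$, where $\widehat\alpha=\min\{\widehat\alpha_u,\widehat\alpha_z\}$, $$\widehat\alpha_u=\begin{cases}+\infty,&\widehat u\le 0,\\ \min_{i:\widehat u_i>0}\frac{\widehat u_i^2}{2\lambda},&\text{otherwise},\end{cases}\qquad \widehat\alpha_z=\begin{cases}+\infty,&\widehat z\le 0,\\ \min_{i:\widehat z_i>0}\frac{2\lambda}{\widehat z_i^2},&\text{otherwise}.\end{cases}$$ (ii) If $f$ is convex, then a $\widetilde{\rm P}$-stationary point of (E) with constant $\alpha>0$ is a local minimizer of (E). (iii) If $f$ is $\sigma_f$-strongly convex, then a $\widetilde{\rm P}$-stationary point of (E) with constant $\alpha>1/\sigma$ is the unique global minimizer of (E), where $\sigma:=\dfrac{\sigma_f\rho\mu}{\sigma_f(\mu+\rho)+\rho\mu\|A\|^2+2\rho\mu}$.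
   Context: Setting: $f:\mathbb{R}^p\to\mathbb{R}$ is smooth (continuously differentiable), $A\in\mathbb{R}^{n\times p}$, $b\in\mathbb{R}^n$, and $\lambda,\rho,\mu>0$. For $u\in\mathbb{R}^n$, $u_+:=(\max\{0,u_1\},\dots,\max\{0,u_n\})^\top$ and $\|u\|_0$ is the number of nonzero components of $u$, so $\|u_+\|_0$ is the number of positive components of $u$. $(w;u)$ denotes concatenation of vectors; vector inequalities are componentwise; $\|A\|$ is the spectral norm. Lyapunov function: $\mathcal{V}_{\rho,\mu}(w,u,z,v):=f(w)+\lambda\|u_+\|_0+\langle z,Aw+b-u\rangle+\frac{\rho}{2}\|Aw+b-u\|^2+\frac{\mu}{2}\|w-v\|^2$. Proximal operator (set-valued): ${\rm Prox}_{\alpha\lambda\|(\cdot)_+\|_0}(z):=\arg\min_{u\in\mathbb{R}^n}\ \lambda\|u_+\|_0+\frac{1}{2\alpha}\|u-z\|^2$ for $\alpha>0$. $(\widehat w;\widehat u;\widehat v)$ is a $\widetilde{\rm P}$-stationary point of (E), with $\widetilde{\rm P}$-stationary multiplier $\widehat z\in\mathbb{R}^n$ and constant $\alpha>0$, if $$\nabla f(\widehat w)+\mu(\widehat w-\widehat v)+A^\top\widehat z=0,\quad \widehat u\in{\rm Prox}_{\alpha\lambda\|(\cdot)_+\|_0}(\widehat u+\alpha\widehat z),\quad \widehat z=\widetilde z+\rho(A\widehat w+b-\widehat u),\quad \widehat v=\widehat w.$$ *)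

theory Defs
  imports "HOL-Analysis.Analysis"
begin

definition pos_part :: "real^'n \<Rightarrow> real^'n" where
  "pos_part u = (\<chi> i. max 0 (u $ i))"

definition norm0 :: "real^'n \<Rightarrow> nat" where
  "norm0 u = card {i. u $ i \<noteq> 0}"

definition lyapunov ::
    "(real^'p \<Rightarrow> real) \<Rightarrow> real^'p^'n \<Rightarrow> real^'n \<Rightarrow> real \<Rightarrow> real \<Rightarrow> real
      \<Rightarrow> real^'p \<Rightarrow> real^'n \<Rightarrow> real^'n \<Rightarrow> real^'p \<Rightarrow> real" where
  "lyapunov f A b lam rho mu w u z v =
     f w + lam * real (norm0 (pos_part u)) + inner z (A *v w + b - u)
       + rho / 2 * (norm (A *v w + b - u))\<^sup>2 + mu / 2 * (norm (w - v))\<^sup>2"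

definition prox :: "real \<Rightarrow> real \<Rightarrow> real^'n \<Rightarrow> (real^'n) set" where
  "prox alpha lam z =
     {u. is_arg_min (\<lambda>x. lam * real (norm0 (pos_part x)) + 1 / (2 * alpha) * (norm (x - z))\<^sup>2)
           (\<lambda>_. True) u}"

(* The parameter g is the gradient of the smooth part f; z is the multiplier. *)
definition P_stationary ::
    "(real^'p \<Rightarrow> real^'p) \<Rightarrow> real^'p^'n \<Rightarrow> real^'n \<Rightarrow> real \<Rightarrow> real \<Rightarrow> real \<Rightarrow> real^'n
      \<Rightarrow> real^'p \<Rightarrow> real^'n \<Rightarrow> real^'p \<Rightarrow> real^'n \<Rightarrow> real \<Rightarrow> bool" where
  "P_stationary g A b lam rho mu zt w u v z alpha \<longleftrightarrow>
     alpha > 0 \<and>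
     g w + mu *\<^sub>R (w - v) + transpose A *v z = 0 \<and>
     u \<in> prox alpha lam (u + alpha *\<^sub>R z) \<and>
     z = zt + rho *\<^sub>R (A *v w + b - u) \<and>
     v = w"

definition alpha_u :: "real \<Rightarrow> real^'n \<Rightarrow> ereal" where
  "alpha_u lam u =
     (if \<forall>i. u $ i \<le> 0 then \<infinity> else ereal (Min {(u $ i)\<^sup>2 / (2 * lam) | i. u $ i > 0}))"

definition alpha_z :: "real \<Rightarrow> real^'n \<Rightarrow> ereal" where
  "alpha_z lam z =
     (if \<forall>i. z $ i \<le> 0 then \<infinity> else ereal (Min {2 * lam / (z $ i)\<^sup>2 | i. z $ i > 0}))"

definition local_minimizer :: "('a::topological_space \<Rightarrow> real) \<Rightarrow> 'a \<Rightarrow> bool" where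
  "local_minimizer F x \<longleftrightarrow> (\<forall>\<^sub>F y in nhds x. F x \<le> F y)"

definition unique_global_minimizer :: "('a \<Rightarrow> real) \<Rightarrow> 'a \<Rightarrow> bool" where
  "unique_global_minimizer F x \<longleftrightarrow> (\<forall>y. is_arg_min F (\<lambda>_. True) y \<longleftrightarrow> y = x)"

definition strongly_convex :: "real \<Rightarrow> ('a::real_normed_vector \<Rightarrow> real) \<Rightarrow> bool" where
  "strongly_convex s F \<longleftrightarrow> s > 0 \<and>
     (\<forall>x y. \<forall>t\<in>{0..1}. F (t *\<^sub>R x + (1 - t) *\<^sub>R y)
        \<le> t * F x + (1 - t) * F y - s / 2 * t * (1 - t) * (norm (x - y))\<^sup>2)"

definition sigma_const :: "real \<Rightarrow> real \<Rightarrow> real \<Rightarrow> real^'p^'n \<Rightarrow> real" where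
  "sigma_const sf rho mu A =
     sf * rho * mu / (sf * (mu + rho) + rho * mu * (onorm ((*v) A))\<^sup>2 + 2 * rho * mu)"

end

theory Submission
  imports Defs
begin

text \<open>
  The Lyapunov function is a smooth function plus the step function
  \<open>lam * \<parallel>u\<^sub>+\<parallel>\<^sub>0\<close>, and for fixed \<open>zt\<close> it is quadratic apart from \<open>f\<close> and the step
  function. Hence its increment from \<open>(w, u, v)\<close> has an exact
  expansion (\<open>lyapunov_increment\<close>), whose first-order part involves precisely the
  multiplier \<open>z = zt + rho (A w + b - u)\<close>: the \<open>u\<close>-gradient of the smooth part is \<open>- z\<close>.
  All three assertions are read off from this expansion.

  The step function is a separable sum of the functions \<open>t \<mapsto> lam\<close> for \<open>t > 0\<close>, \<open>t \<mapsto> 0\<close>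
  otherwise. For a vector \<open>z\<close>, the following three conditions are equivalent: \<open>z\<close> is a subgradient
  of the step function at \<open>u\<close> up to a quadratic error and locally; \<open>z\<close> is nonnegative and vanishes
  wherever \<open>u\<close> does not; \<open>z\<close> is a local subgradient at \<open>u\<close> without any error. The
  reason is that each coordinate may be decreased, and a nonzero one may be moved slightly either way,
  without raising the step function, while crossing upwards from zero costs the fixed
  amount \<open>lam\<close>, which beats every small linear gain
  (\<open>prox_subgradient_sign_conditions\<close>, \<open>local_subgradient_of_sign_conditions\<close>). The
  proximal fixed-point condition is the global version with quadratic error
  \<open>\<parallel>y - u\<parallel>\<^sup>2 / (2 alpha)\<close>. It follows from the sign conditions as soon as \<open>alpha\<close> is so small that
  neither switching a positive coordinate of \<open>u\<close> off nor switching a zero coordinate with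
  \<open>z $ i > 0\<close> on pays off; these are the two thresholds for \<open>alpha\<close>.

  (i) A local minimizer is a local minimizer in each of its three blocks. In the \<open>w\<close> and \<open>v\<close> blocks
  this gives the two equations, in the \<open>u\<close> block it makes \<open>z\<close> a local subgradient up to a
  quadratic error, hence the sign conditions, hence the proximal condition for small \<open>alpha\<close>.

  (ii) At a stationary point the gradient inequality for \<open>f\<close> cancels every first-order term of the
  expansion except \<open>- \<langle>z, u' - u\<rangle>\<close>, and the local subgradient inequality compensates this one.

  (iii) Strong convexity leaves the quadratic surplus
  \<open>sf \<parallel>dw\<parallel>\<^sup>2 + rho \<parallel>A dw - du\<parallel>\<^sup>2 + mu \<parallel>dw - dv\<parallel>\<^sup>2\<close> (times one half), while using the proximal
  inequality globally costs \<open>\<parallel>du\<parallel>\<^sup>2 / alpha\<close> (times one half). Since \<open>du = A dw - (A dw - du)\<close>,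
  the first two surplus terms already control \<open>sigma \<parallel>du\<parallel>\<^sup>2\<close>, and \<open>sigma > 1 / alpha\<close> makes the
  increment strictly positive away from the stationary point.
\<close>

section \<open>The increment of the Lyapunov function\<close>

lemma norm0_pos_part_eq_sum:
  "real (norm0 (pos_part u)) = (\<Sum>i\<in>UNIV. if u $ i > 0 then 1 else 0)"
proof -
  have "{i. pos_part u $ i \<noteq> 0} = {i. u $ i > 0}"
    by (auto simp: pos_part_def max_def)
  then show ?thesis
    by (simp add: norm0_def sum.If_cases)
qed

text \<open>
  No remainder terms appear, since everything except \<open>f\<close> and the step function is quadratic. The
  gradient \<open>A\<^sup>T zt + rho A\<^sup>T (A w + b - u)\<close> of the constraint terms collapses to \<open>A\<^sup>T z\<close>, which
  is why \<open>z\<close> is the multiplier.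
\<close>

lemma lyapunov_increment:
  fixes A :: "real^'p^'n"
  assumes z: "z = zt + rho *\<^sub>R (A *v w + b - u)"
  shows "lyapunov f A b lam rho mu w' u' zt v' =
      lyapunov f A b lam rho mu w u zt v + (f w' - f w)
      + lam * (real (norm0 (pos_part u')) - real (norm0 (pos_part u)))
      + inner (mu *\<^sub>R (w - v) + transpose A *v z) (w' - w)
      - inner z (u' - u) - mu * inner (w - v) (v' - v)
      + rho / 2 * (norm (A *v (w' - w) - (u' - u)))\<^sup>2
      + mu / 2 * (norm ((w' - w) - (v' - v)))\<^sup>2"
proof -
  define dw where "dw = w' - w"
  define du where "du = u' - u"
  define dv where "dv = v' - v"
  define r where "r = A *v w + b - u"
  define e where "e = A *v dw - du"
  have r': "A *v w' + b - u' = r + e"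
    by (simp add: r_def e_def dw_def du_def matrix_vector_mult_diff_distrib)
  have v': "w' - v' = (w - v) + (dw - dv)"
    by (simp add: dw_def dv_def)
  have sq: "(norm (x + y))\<^sup>2 = (norm x)\<^sup>2 + 2 * inner x y + (norm y)\<^sup>2" for x y :: "'a::real_inner"
    by (simp add: power2_norm_eq_inner inner_add_left inner_add_right inner_commute)
  \<comment> \<open>the linear terms in \<open>zt\<close> and \<open>r\<close> combine into \<open>z\<close>, once the transpose is moved across\<close>
  have adj: "inner (transpose A *v z) dw = inner z (A *v dw)"
    by (metis dot_lmul_matrix vector_transpose_matrix transpose_transpose)
  have ez: "inner z e = inner zt e + rho * inner r e"
    by (simp add: z r_def inner_add_left)
  have ze: "inner z e = inner z (A *v dw) - inner z du"
    by (simp add: e_def inner_diff_right)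
  show ?thesis
    unfolding lyapunov_def r' v' r_def[symmetric] dw_def[symmetric] du_def[symmetric]
      dv_def[symmetric] e_def[symmetric] sq inner_add_left inner_add_right adj
    using ez ze by (simp add: algebra_simps inner_diff_right)
qed

section \<open>First-order conditions for the smooth part\<close>

text \<open>
  Fermat's rule in the form that the expansion delivers: the quadratic term is centred at \<open>x\<close>, so it
  has zero gradient there, and an upper bound with any constant \<open>K\<close> suffices.
\<close>

lemma stationary_of_local_min_quadratic:
  fixes f :: "'a::real_inner \<Rightarrow> real"
  assumes f: "GDERIV f x :> G"
    and min: "\<forall>\<^sub>F y in nhds x. f x \<le> f y + inner c (y - x) + K * (norm (y - x))\<^sup>2"
  shows "G + c = 0"
proof -
  let ?h = "\<lambda>y. f y + inner c (y - x) + K * inner (y - x) (y - x)"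
  obtain S where S: "open S" "x \<in> S" "\<forall>y\<in>S. ?h x \<le> ?h y"
    using min by (auto simp: eventually_nhds power2_norm_eq_inner)
  have "(?h has_derivative (\<lambda>d. inner d (G + c))) (at x)"
    by (rule derivative_eq_intros f[unfolded gderiv_def] refl)+
      (simp add: inner_add_right inner_commute)
  then have "(\<lambda>d. inner d (G + c)) = (\<lambda>d. 0)"
    using S by (intro differential_zero_maxmin[where S = S]) auto
  then have "inner (G + c) (G + c) = 0"
    by meson
  then show ?thesis
    by simp
qed

text \<open>
  Dividing the convexity inequality by \<open>t\<close> bounds the difference quotient of \<open>f\<close> along the segment
  from \<open>x\<close> to \<open>y\<close>; now let \<open>t\<close> tend to 0. Convexity is \<open>s = 0\<close>, strong convexity \<open>s > 0\<close>.
\<close>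

lemma convex_gradient_inequality:
  fixes f :: "'a::real_inner \<Rightarrow> real"
  assumes f: "GDERIV f x :> G"
    and conv: "\<And>t. 0 < t \<Longrightarrow> t < 1 \<Longrightarrow>
      f (t *\<^sub>R y + (1 - t) *\<^sub>R x) \<le> t * f y + (1 - t) * f x - s / 2 * t * (1 - t) * (norm (y - x))\<^sup>2"
  shows "f x + inner G (y - x) + s / 2 * (norm (y - x))\<^sup>2 \<le> f y"
proof -
  have "((\<lambda>t. f (x + t *\<^sub>R (y - x))) has_derivative (\<lambda>t. inner (t *\<^sub>R (y - x)) G)) (at 0)"
    by (rule has_derivative_compose[of "\<lambda>t. x + t *\<^sub>R (y - x)" "\<lambda>t. t *\<^sub>R (y - x)"])
      (auto intro!: derivative_eq_intros f[unfolded gderiv_def] simp: f[unfolded gderiv_def])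
  then have "DERIV (\<lambda>t. f (x + t *\<^sub>R (y - x))) 0 :> inner G (y - x)"
    by (simp add: has_field_derivative_def inner_commute mult_commute_abs)
  then have "((\<lambda>t. (f (x + t *\<^sub>R (y - x)) - f x) / t) \<longlongrightarrow> inner G (y - x)) (at 0)"
    by (simp add: DERIV_def)
  then have lim: "((\<lambda>t. (f (x + t *\<^sub>R (y - x)) - f x) / t) \<longlongrightarrow> inner G (y - x)) (at_right 0)"
    by (rule filterlim_mono) (auto simp: at_within_le_at)
  have lim2: "((\<lambda>t. f y - f x - s / 2 * (1 - t) * (norm (y - x))\<^sup>2)
      \<longlongrightarrow> f y - f x - s / 2 * (1 - 0) * (norm (y - x))\<^sup>2) (at_right 0)"
    by (intro tendsto_intros)
  have "\<forall>\<^sub>F t in at_right 0. (f (x + t *\<^sub>R (y - x)) - f x) / t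
      \<le> f y - f x - s / 2 * (1 - t) * (norm (y - x))\<^sup>2"
    using eventually_at_right_real[OF zero_less_one]
  proof eventually_elim
    case (elim t)
    have "x + t *\<^sub>R (y - x) = t *\<^sub>R y + (1 - t) *\<^sub>R x"
      by (simp add: algebra_simps)
    with conv[of t] elim have "f (x + t *\<^sub>R (y - x)) - f x
        \<le> t * (f y - f x - s / 2 * (1 - t) * (norm (y - x))\<^sup>2)"
      by (simp add: algebra_simps)
    then show ?case
      using elim by (simp add: pos_divide_le_eq mult.commute)
  qed
  from tendsto_le[OF _ lim2 lim this] show ?thesis
    by simp
qed

section \<open>Subgradients of the step function and the proximal operator\<close>

text \<open>
  Move \<open>u\<close> for a short time \<open>t\<close> in coordinate \<open>i\<close> with speed \<open>s\<close>, in a direction that cannot raise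
  the number of positive coordinates: any \<open>s\<close> if \<open>u $ i \<noteq> 0\<close>, and \<open>s \<le> 0\<close> if \<open>u $ i = 0\<close>. The linear term \<open>t * z $ i * s\<close> is
  then bounded by a multiple of \<open>t\<^sup>2\<close>, which forces \<open>z $ i * s \<le> 0\<close>. Both local minimality of the
  Lyapunov function and the proximal condition supply the hypothesis, with different \<open>K\<close>.
\<close>

lemma prox_subgradient_sign_conditions:
  fixes u z :: "real^'n"
  assumes lam: "lam > 0"
    and sub: "\<forall>\<^sub>F y in nhds u. lam * real (norm0 (pos_part u)) + inner z (y - u)
        \<le> lam * real (norm0 (pos_part y)) + K * (norm (y - u))\<^sup>2"
  shows "0 \<le> z $ i \<and> (u $ i \<noteq> 0 \<longrightarrow> z $ i = 0)"
proof -
  have main: "z $ i * s \<le> 0" if s: "u $ i \<noteq> 0 \<or> s \<le> 0" for s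
  proof -
    let ?y = "\<lambda>t. u + (t * s) *\<^sub>R axis i 1"
    have lim: "(?y \<longlongrightarrow> u) (at_right 0)"
      by (auto intro!: tendsto_eq_intros)
    have nc: "\<forall>\<^sub>F t in at_right 0. 0 < u $ i + t * s \<longrightarrow> 0 < u $ i"
    proof (cases "u $ i < 0")
      case True
      have "((\<lambda>t. u $ i + t * s) \<longlongrightarrow> u $ i) (at_right 0)"
        by (auto intro!: tendsto_eq_intros)
      from order_tendstoD(2)[OF this True] show ?thesis
        by eventually_elim auto
    next
      case False
      show ?thesis
        using eventually_at_right_less[of "0::real"]
      proof eventually_elim
        case (elim t)
        have "u $ i > 0 \<or> t * s \<le> 0"
          using False s elim by (auto simp: mult_le_0_iff)
        with False show ?case
          by auto
      qed
    qed
    have "\<forall>\<^sub>F t in at_right 0. z $ i * s \<le> K * t * s\<^sup>2"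
      using filterlim_iff[THEN iffD1, OF lim, rule_format, OF sub] nc eventually_at_right_less[of "0::real"]
    proof eventually_elim
      case (elim t)
      have "real (norm0 (pos_part (?y t))) \<le> real (norm0 (pos_part u))"
        unfolding norm0_pos_part_eq_sum using elim(2)
        by (intro sum_mono) (auto simp: axis_def)
      then have "lam * real (norm0 (pos_part (?y t))) \<le> lam * real (norm0 (pos_part u))"
        using lam by simp
      moreover have "inner z (?y t - u) = t * (z $ i * s)"
        by (simp add: inner_axis)
      moreover have "(norm (?y t - u))\<^sup>2 = t * (t * s\<^sup>2)"
        by (simp add: power2_eq_square)
      ultimately have "t * (z $ i * s) \<le> t * (K * t * s\<^sup>2)"
        using elim(1) by (simp only:) (simp add: algebra_simps)
      with elim(3) show ?case
        by (simp only: mult_le_cancel_left_pos)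
    qed
    moreover have "((\<lambda>t. K * t * s\<^sup>2) \<longlongrightarrow> 0) (at_right 0)"
      by (auto intro!: tendsto_eq_intros)
    ultimately show ?thesis
      by (intro tendsto_lowerbound) auto
  qed
  show ?thesis
    using main[of "-1"] main[of 1] by auto
qed

text \<open>
  It suffices to argue in each coordinate. Where \<open>u\<close> is nonzero, \<open>z\<close> vanishes and the step function
  is locally constant. Where \<open>u\<close> is zero, an upward move gains at most \<open>z $ i * y $ i < lam\<close> if it
  is short, and a downward move gains nothing.
\<close>

lemma local_subgradient_of_sign_conditions:
  fixes u z :: "real^'n"
  assumes lam: "lam > 0"
    and sgn: "\<And>i. 0 \<le> z $ i" "\<And>i. u $ i \<noteq> 0 \<Longrightarrow> z $ i = 0"
  shows "\<forall>\<^sub>F y in nhds u. lam * real (norm0 (pos_part u)) + inner z (y - u)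
        \<le> lam * real (norm0 (pos_part y))"
proof -
  let ?s = "\<lambda>t::real. if t > 0 then 1 else (0::real)"
  have comp: "\<forall>\<^sub>F y in nhds u. lam * ?s (u $ i) + z $ i * (y $ i - u $ i) \<le> lam * ?s (y $ i)" for i
  proof -
    have lim: "((\<lambda>y. y $ i) \<longlongrightarrow> u $ i) (nhds u)"
      by (intro tendsto_vec_nth filterlim_ident)
    consider "u $ i > 0" | "u $ i < 0" | "u $ i = 0"
      by linarith
    then show ?thesis
    proof cases
      case 1
      from order_tendstoD(1)[OF lim 1] show ?thesis
        by eventually_elim (use 1 sgn(2)[of i] in auto)
    next
      case 2
      then show ?thesis
        using lam sgn(2)[of i] by auto
    next
      case 3
      have "((\<lambda>y. z $ i * y $ i) \<longlongrightarrow> z $ i * u $ i) (nhds u)"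
        by (intro tendsto_intros lim)
      then have "\<forall>\<^sub>F y in nhds u. z $ i * y $ i < lam"
        using 3 lam by (intro order_tendstoD(2)) auto
      then show ?thesis
        by eventually_elim (use 3 sgn(1)[of i] in \<open>auto simp: mult_le_0_iff\<close>)
    qed
  qed
  have "\<forall>\<^sub>F y in nhds u. \<forall>i. lam * ?s (u $ i) + z $ i * (y $ i - u $ i) \<le> lam * ?s (y $ i)"
    using comp by (rule eventually_all_finite)
  then show ?thesis
  proof eventually_elim
    case (elim y)
    then have "(\<Sum>i\<in>UNIV. lam * ?s (u $ i) + z $ i * (y $ i - u $ i)) \<le> (\<Sum>i\<in>UNIV. lam * ?s (y $ i))"
      by (intro sum_mono) auto
    then show ?case
      unfolding norm0_pos_part_eq_sum inner_vec_def by (simp add: sum.distrib sum_distrib_left)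
  qed
qed

text \<open>
  Expanding \<open>\<parallel>y - u - alpha z\<parallel>\<^sup>2\<close> around \<open>y = u\<close> turns the proximal fixed-point condition into a
  subgradient inequality with a quadratic error. In this form it fits the expansion of the
  Lyapunov function.
\<close>

lemma prox_fixed_point_iff_subgradient:
  fixes u z :: "real^'n"
  assumes "alpha > 0"
  shows "u \<in> prox alpha lam (u + alpha *\<^sub>R z) \<longleftrightarrow>
    (\<forall>y. lam * real (norm0 (pos_part u)) + inner z (y - u)
        \<le> lam * real (norm0 (pos_part y)) + 1 / (2 * alpha) * (norm (y - u))\<^sup>2)"
proof -
  have sq: "1 / (2 * alpha) * (norm (y - (u + alpha *\<^sub>R z)))\<^sup>2
      = 1 / (2 * alpha) * (norm (u - (u + alpha *\<^sub>R z)))\<^sup>2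
        + 1 / (2 * alpha) * (norm (y - u))\<^sup>2 - inner z (y - u)" for y
  proof -
    have "y - (u + alpha *\<^sub>R z) = (y - u) - alpha *\<^sub>R z" "u - (u + alpha *\<^sub>R z) = - (alpha *\<^sub>R z)"
      by simp_all
    then have "(norm (y - (u + alpha *\<^sub>R z)))\<^sup>2
        = (norm (y - u))\<^sup>2 - 2 * alpha * inner z (y - u) + (norm (u - (u + alpha *\<^sub>R z)))\<^sup>2"
      by (simp only: power2_norm_eq_inner) (simp add: inner_diff_left inner_diff_right inner_commute algebra_simps)
    then show ?thesis
      using assms by (simp add: field_simps)
  qed
  show ?thesis
    unfolding prox_def is_arg_min_def mem_Collect_eq
    by (subst sq) (auto simp: not_less algebra_simps)
qed

text \<open>
  For \<open>alpha\<close> below the two thresholds the local inequality becomes global at the price of the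
  quadratic error: moving a positive coordinate of \<open>u\<close> to a nonpositive value saves \<open>lam\<close> but costs at
  least \<open>(u $ i)\<^sup>2 / (2 alpha)\<close>, and raising a zero coordinate with \<open>z $ i > 0\<close> gains at most
  \<open>alpha (z $ i)\<^sup>2 / 2\<close>, the maximum of \<open>z $ i * t - t\<^sup>2 / (2 alpha)\<close>, but costs \<open>lam\<close>.
\<close>

lemma prox_fixed_point_of_sign_conditions:
  fixes u z :: "real^'n"
  assumes alpha: "alpha > 0"
    and sgn: "\<And>i. 0 \<le> z $ i" "\<And>i. u $ i \<noteq> 0 \<Longrightarrow> z $ i = 0"
    and u: "\<And>i. u $ i > 0 \<Longrightarrow> 2 * alpha * lam \<le> (u $ i)\<^sup>2"
    and z: "\<And>i. z $ i > 0 \<Longrightarrow> alpha * (z $ i)\<^sup>2 \<le> 2 * lam"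
    and lam: "lam > 0"
  shows "u \<in> prox alpha lam (u + alpha *\<^sub>R z)"
  unfolding prox_fixed_point_iff_subgradient[OF alpha]
proof
  fix y
  let ?s = "\<lambda>t::real. if t > 0 then 1 else (0::real)"
  have comp: "lam * ?s (u $ i) + z $ i * (y $ i - u $ i)
      \<le> lam * ?s (y $ i) + 1 / (2 * alpha) * (y $ i - u $ i)\<^sup>2" for i
  proof (cases "z $ i = 0")
    case True
    have "lam \<le> (y $ i - u $ i)\<^sup>2 / (2 * alpha)" if "u $ i > 0" "y $ i \<le> 0"
    proof -
      have "(u $ i)\<^sup>2 \<le> (u $ i - y $ i)\<^sup>2"
        using that by (intro power_mono) auto
      with u[OF that(1)] have "2 * alpha * lam \<le> (y $ i - u $ i)\<^sup>2"
        by (simp add: power2_commute)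
      then show ?thesis
        using alpha by (simp add: pos_le_divide_eq mult.commute mult.left_commute)
    qed
    then show ?thesis
      using True lam alpha by auto
  next
    case False
    then have 0: "u $ i = 0" "z $ i > 0"
      using sgn[of i] by (auto simp: less_le)
    \<comment> \<open>\<open>t = alpha * z $ i\<close> maximizes \<open>z $ i * t - t\<^sup>2 / (2 * alpha)\<close>\<close>
    have "0 \<le> (y $ i - alpha * z $ i)\<^sup>2"
      by simp
    then have "2 * alpha * (z $ i * y $ i) \<le> (y $ i)\<^sup>2 + alpha * (alpha * (z $ i)\<^sup>2)"
      by (simp add: power2_eq_square algebra_simps)
    also have "\<dots> \<le> (y $ i)\<^sup>2 + alpha * (2 * lam)"
      using z[OF 0(2)] alpha by simp
    finally have "z $ i * y $ i \<le> lam + (y $ i)\<^sup>2 / (2 * alpha)"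
      using alpha by (simp add: field_simps)
    moreover have "z $ i * y $ i \<le> (y $ i)\<^sup>2 / (2 * alpha)" if "y $ i \<le> 0"
    proof -
      have "z $ i * y $ i \<le> 0"
        using that 0 by (simp add: mult_le_0_iff)
      also have "0 \<le> (y $ i)\<^sup>2 / (2 * alpha)"
        using alpha by simp
      finally show ?thesis .
    qed
    ultimately show ?thesis
      using 0 by auto
  qed
  have "(\<Sum>i\<in>UNIV. lam * ?s (u $ i) + z $ i * (y $ i - u $ i))
      \<le> (\<Sum>i\<in>UNIV. lam * ?s (y $ i) + 1 / (2 * alpha) * (y $ i - u $ i)\<^sup>2)"
    by (intro sum_mono comp)
  then show "lam * real (norm0 (pos_part u)) + inner z (y - u)
        \<le> lam * real (norm0 (pos_part y)) + 1 / (2 * alpha) * (norm (y - u))\<^sup>2"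
    unfolding norm0_pos_part_eq_sum power2_norm_eq_inner inner_vec_def
    by (simp add: sum.distrib sum_distrib_left power2_eq_square)
qed

lemma less_alpha_u_D:
  assumes "ereal alpha < alpha_u lam u" "u $ i > 0"
  shows "alpha < (u $ i)\<^sup>2 / (2 * lam)"
proof -
  have "finite {(u $ i)\<^sup>2 / (2 * lam) | i. u $ i > 0}"
    by simp
  then have "Min {(u $ i)\<^sup>2 / (2 * lam) | i. u $ i > 0} \<le> (u $ i)\<^sup>2 / (2 * lam)"
    using assms(2) by (intro Min_le) auto
  then show ?thesis
    using assms by (auto simp: alpha_u_def not_le not_less split: if_splits dest: spec[of _ i])
qed

lemma less_alpha_z_D:
  assumes "ereal alpha < alpha_z lam z" "z $ i > 0"
  shows "alpha < 2 * lam / (z $ i)\<^sup>2"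
proof -
  have "finite {2 * lam / (z $ i)\<^sup>2 | i. z $ i > 0}"
    by simp
  then have "Min {2 * lam / (z $ i)\<^sup>2 | i. z $ i > 0} \<le> 2 * lam / (z $ i)\<^sup>2"
    using assms(2) by (intro Min_le) auto
  then show ?thesis
    using assms by (auto simp: alpha_z_def not_le not_less split: if_splits dest: spec[of _ i])
qed

section \<open>Growth of the Lyapunov function at a stationary point\<close>

text \<open>
  The stationarity equations turn the first-order part of the expansion into
  \<open>- \<langle>g w, w' - w\<rangle> - \<langle>z, u' - u\<rangle>\<close>, and the gradient inequality for \<open>f\<close> absorbs the first term.
\<close>

lemma lyapunov_lower_bound_at_P_stationary:
  fixes A :: "real^'p^'n"
  assumes st: "P_stationary g A b lam rho mu zt w u v z alpha"
    and grad: "f w + inner (g w) (w' - w) + s / 2 * (norm (w' - w))\<^sup>2 \<le> f w'"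
  shows "lyapunov f A b lam rho mu w u zt v
      + lam * (real (norm0 (pos_part u')) - real (norm0 (pos_part u))) - inner z (u' - u)
      + s / 2 * (norm (w' - w))\<^sup>2 + rho / 2 * (norm (A *v (w' - w) - (u' - u)))\<^sup>2
      + mu / 2 * (norm ((w' - w) - (v' - v)))\<^sup>2
    \<le> lyapunov f A b lam rho mu w' u' zt v'"
proof -
  have z: "z = zt + rho *\<^sub>R (A *v w + b - u)" and v: "v = w"
    and "g w + mu *\<^sub>R (w - v) + transpose A *v z = 0"
    using st unfolding P_stationary_def by blast+
  then have "mu *\<^sub>R (w - v) + transpose A *v z = - g w"
    by (metis add.assoc add.commute eq_neg_iff_add_eq_0)
  then show ?thesis
    using grad lyapunov_increment[OF z, of f lam mu w' u' v' v] by (simp add: v)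
qed

lemma sigma_const_pos:
  assumes "sf > 0" "rho > 0" "mu > 0"
  shows "sigma_const sf rho mu A > 0"
  unfolding sigma_const_def using assms
  by (intro divide_pos_pos add_nonneg_pos mult_pos_pos add_nonneg_nonneg) auto

text \<open>
  With \<open>a\<close> the spectral norm of \<open>A\<close>, the triangle inequality gives
  \<open>\<parallel>d\<parallel> \<le> a \<parallel>x\<parallel> + \<parallel>A x - d\<parallel>\<close>, and Cauchy-Schwarz with weights \<open>sf\<close> and \<open>rho\<close> gives the bound with
  the constant \<open>sf rho / (sf + rho a\<^sup>2)\<close>, which is at least \<open>sigma_const\<close>.
\<close>

lemma sigma_const_quadratic_bound:
  fixes A :: "real^'p^'n"
  assumes sf: "sf > 0" and rho: "rho > 0" and mu: "mu > 0"
  shows "sigma_const sf rho mu A * (norm d)\<^sup>2 \<le> sf * (norm x)\<^sup>2 + rho * (norm (A *v x - d))\<^sup>2"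
proof -
  let ?a = "onorm ((*v) A)" and ?p = "norm x" and ?r = "norm (A *v x - d)"
  let ?D = "sf * (mu + rho) + rho * mu * ?a\<^sup>2 + 2 * rho * mu"
  let ?Q = "sf * ?p\<^sup>2 + rho * ?r\<^sup>2"
  have D: "?D > 0"
    using assms by (intro add_nonneg_pos mult_pos_pos add_nonneg_nonneg) auto
  have Q: "?Q \<ge> 0"
    using assms by simp
  have "norm d \<le> norm (A *v x) + ?r"
    using norm_triangle_ineq4[of "A *v x" "A *v x - d"] by simp
  also have "\<dots> \<le> ?a * ?p + ?r"
    using onorm[OF matrix_vector_mul_bounded_linear[of A], of x] by simp
  finally have "(norm d)\<^sup>2 \<le> (?a * ?p + ?r)\<^sup>2"
    by (intro power_mono) auto
  then have "sf * rho * mu * (norm d)\<^sup>2 \<le> sf * rho * mu * (?a * ?p + ?r)\<^sup>2"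
    using assms by simp
  \<comment> \<open>the defect in the weighted Cauchy-Schwarz inequality, by Lagrange's identity\<close>
  also have "\<dots> = mu * ((rho * ?a\<^sup>2 + sf) * ?Q - (rho * ?a * ?r - sf * ?p)\<^sup>2)"
    by (simp add: power2_eq_square algebra_simps)
  also have "\<dots> \<le> mu * ((rho * ?a\<^sup>2 + sf) * ?Q)"
    using mu by simp
  also have "\<dots> = (mu * (rho * ?a\<^sup>2 + sf)) * ?Q"
    by simp
  also have "\<dots> \<le> ?D * ?Q"
    using assms Q by (intro mult_right_mono) (auto simp: algebra_simps)
  finally show ?thesis
    unfolding sigma_const_def using D by (simp add: field_simps)
qed

section \<open>Stationarity and minimality\<close>

theorem theorem1:
  fixes f :: "real^'p \<Rightarrow> real" and g :: "real^'p \<Rightarrow> real^'p"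
    and A :: "real^'p^'n" and b zt :: "real^'n" and lam rho mu :: real
  assumes "\<forall>w. GDERIV f w :> g w" and "continuous_on UNIV g"
    and "lam > 0" and "rho > 0" and "mu > 0"
  defines "E \<equiv> \<lambda>(w, u, v). lyapunov f A b lam rho mu w u zt v"
  shows "(\<forall>w u v. local_minimizer E (w, u, v) \<longrightarrow>
            (\<exists>z. \<forall>alpha. 0 < alpha \<and> ereal alpha < min (alpha_u lam u) (alpha_z lam z) \<longrightarrow>
               P_stationary g A b lam rho mu zt w u v z alpha)) \<and>
         (convex_on UNIV f \<longrightarrow>
            (\<forall>w u v z alpha. P_stationary g A b lam rho mu zt w u v z alpha \<longrightarrow>
               local_minimizer E (w, u, v))) \<and>
         (\<forall>sf. strongly_convex sf f \<longrightarrow>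
            (\<forall>w u v z alpha. P_stationary g A b lam rho mu zt w u v z alpha \<and>
               alpha > 1 / sigma_const sf rho mu A \<longrightarrow>
               unique_global_minimizer E (w, u, v)))"
proof -
  have E: "E (w, u, v) = lyapunov f A b lam rho mu w u zt v" for w u v
    by (simp add: E_def)
  have gd: "GDERIV f w :> g w" for w
    using assms(1) by blast
  show ?thesis
  proof (intro conjI allI impI)
    fix w u v
    assume min: "local_minimizer E (w, u, v)"
    define z where "z = zt + rho *\<^sub>R (A *v w + b - u)"
    note inc = lyapunov_increment[OF z_def, of f lam mu]
    have lim: "((\<lambda>y. (y, u, v)) \<longlongrightarrow> (w, u, v)) (nhds w)"
      "((\<lambda>y. (w, y, v)) \<longlongrightarrow> (w, u, v)) (nhds u)"
      "((\<lambda>y. (w, u, y)) \<longlongrightarrow> (w, u, v)) (nhds v)"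
      by (intro tendsto_intros filterlim_ident)+
    have mins: "\<forall>\<^sub>F y in nhds w. E (w, u, v) \<le> E (y, u, v)"
      "\<forall>\<^sub>F y in nhds u. E (w, u, v) \<le> E (w, y, v)"
      "\<forall>\<^sub>F y in nhds v. E (w, u, v) \<le> E (w, u, y)"
      using min lim unfolding local_minimizer_def filterlim_iff by blast+
    have "\<forall>\<^sub>F y in nhds w. f w \<le> f y + inner (mu *\<^sub>R (w - v) + transpose A *v z) (y - w)
        + (rho / 2 * (onorm ((*v) A))\<^sup>2 + mu / 2) * (norm (y - w))\<^sup>2"
      using mins(1)
    proof eventually_elim
      case (elim y)
      have "(norm (A *v (y - w)))\<^sup>2 \<le> (onorm ((*v) A) * norm (y - w))\<^sup>2"
        using onorm[OF matrix_vector_mul_bounded_linear[of A]] by (intro power_mono) auto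
      then have "rho / 2 * (norm (A *v (y - w)))\<^sup>2 \<le> rho / 2 * (onorm ((*v) A) * norm (y - w))\<^sup>2"
        using \<open>rho > 0\<close> by simp
      with elim show ?case
        unfolding E inc[of y u v v] by (simp add: power_mult_distrib algebra_simps)
    qed
    from stationary_of_local_min_quadratic[OF gd this]
    have W: "g w + mu *\<^sub>R (w - v) + transpose A *v z = 0"
      by (simp add: add.assoc)
    \<comment> \<open>the \<open>v\<close> block is Fermat's rule for the zero function, with \<open>c = - mu (w - v)\<close>\<close>
    have "\<forall>\<^sub>F y in nhds v. 0 \<le> 0 + inner (- mu *\<^sub>R (w - v)) (y - v) + mu / 2 * (norm (y - v))\<^sup>2"
      using mins(3)
    proof eventually_elim
      case (elim y)
      then show ?case
        unfolding E using inc[of w u y v] by (simp add: norm_minus_commute)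
    qed
    from stationary_of_local_min_quadratic[OF GDERIV_const this]
    have V: "v = w"
      using \<open>mu > 0\<close> by simp
    have "\<forall>\<^sub>F y in nhds u. lam * real (norm0 (pos_part u)) + inner z (y - u)
        \<le> lam * real (norm0 (pos_part y)) + rho / 2 * (norm (y - u))\<^sup>2"
      using mins(2)
    proof eventually_elim
      case (elim y)
      then show ?case
        unfolding E using inc[of w y v v] by (simp add: right_diff_distrib norm_minus_commute)
    qed
    note sgn = prox_subgradient_sign_conditions[OF \<open>lam > 0\<close> this]
    show "\<exists>z. \<forall>alpha. 0 < alpha \<and> ereal alpha < min (alpha_u lam u) (alpha_z lam z) \<longrightarrow>
        P_stationary g A b lam rho mu zt w u v z alpha"
    proof (intro exI[of _ z] allI impI)
      fix alpha
      assume al: "0 < alpha \<and> ereal alpha < min (alpha_u lam u) (alpha_z lam z)"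
      have "u \<in> prox alpha lam (u + alpha *\<^sub>R z)"
      proof (rule prox_fixed_point_of_sign_conditions)
        show "2 * alpha * lam \<le> (u $ i)\<^sup>2" if "u $ i > 0" for i
          using less_alpha_u_D[of alpha lam u i] that al \<open>lam > 0\<close> by (simp add: field_simps)
        show "alpha * (z $ i)\<^sup>2 \<le> 2 * lam" if "z $ i > 0" for i
          using less_alpha_z_D[of alpha lam z i] that al by (simp add: field_simps)
      qed (use sgn al \<open>lam > 0\<close> in auto)
      then show "P_stationary g A b lam rho mu zt w u v z alpha"
        unfolding P_stationary_def using al W V z_def by simp
    qed
  next
    fix w u v z alpha
    assume conv: "convex_on UNIV f" and st: "P_stationary g A b lam rho mu zt w u v z alpha"
    have "alpha > 0" and prox: "u \<in> prox alpha lam (u + alpha *\<^sub>R z)"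
      using st unfolding P_stationary_def by blast+
    have fo: "f w + inner (g w) (y - w) + 0 / 2 * (norm (y - w))\<^sup>2 \<le> f y" for y
      using convex_gradient_inequality[of f w "g w" y 0] assms(1) convex_onD[OF conv, of _ w y]
      by (auto simp: algebra_simps)
    have "\<forall>\<^sub>F y in nhds u. lam * real (norm0 (pos_part u)) + inner z (y - u)
        \<le> lam * real (norm0 (pos_part y)) + 1 / (2 * alpha) * (norm (y - u))\<^sup>2"
      using prox \<open>alpha > 0\<close> by (simp add: prox_fixed_point_iff_subgradient)
    note sgn = prox_subgradient_sign_conditions[OF \<open>lam > 0\<close> this]
    have "((\<lambda>x. fst (snd x)) \<longlongrightarrow> u) (nhds (w, u, v))"
      by (auto intro!: tendsto_eq_intros filterlim_ident)
    with local_subgradient_of_sign_conditions[OF \<open>lam > 0\<close>, of z u] sgn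
    have "\<forall>\<^sub>F x in nhds (w, u, v). lam * real (norm0 (pos_part u)) + inner z (fst (snd x) - u)
          \<le> lam * real (norm0 (pos_part (fst (snd x))))"
      unfolding filterlim_iff by blast
    then show "local_minimizer E (w, u, v)"
      unfolding local_minimizer_def
    proof eventually_elim
      case (elim x)
      obtain w' u' v' where x: "x = (w', u', v')"
        by (cases x) auto
      have "0 \<le> rho / 2 * (norm (A *v (w' - w) - (u' - u)))\<^sup>2" "0 \<le> mu / 2 * (norm ((w' - w) - (v' - v)))\<^sup>2"
        using \<open>rho > 0\<close> \<open>mu > 0\<close> by auto
      with elim lyapunov_lower_bound_at_P_stationary[where f = f and v' = v' and u' = u', OF st fo[of w']]
      show ?case
        unfolding x E by (simp add: right_diff_distrib)
    qed
  next
    fix sf w u v z alpha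
    assume sc: "strongly_convex sf f"
      and "P_stationary g A b lam rho mu zt w u v z alpha \<and> alpha > 1 / sigma_const sf rho mu A"
    then have st: "P_stationary g A b lam rho mu zt w u v z alpha"
      and al: "alpha > 1 / sigma_const sf rho mu A"
      by auto
    have "alpha > 0" and prox: "u \<in> prox alpha lam (u + alpha *\<^sub>R z)"
      using st unfolding P_stationary_def by blast+
    have "sf > 0"
      using sc by (simp add: strongly_convex_def)
    have fo: "f w + inner (g w) (y - w) + sf / 2 * (norm (y - w))\<^sup>2 \<le> f y" for y
      using assms(1) sc by (intro convex_gradient_inequality) (auto simp: strongly_convex_def)
    let ?s = "sigma_const sf rho mu A"
    have s: "?s > 0"
      using sigma_const_pos \<open>sf > 0\<close> \<open>rho > 0\<close> \<open>mu > 0\<close> .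
    have gap: "1 / alpha < ?s"
      using al s \<open>alpha > 0\<close> by (simp add: field_simps)
    have less: "E (w, u, v) < E (w', u', v')" if ne: "(w', u', v') \<noteq> (w, u, v)" for w' u' v'
    proof -
      let ?dw = "w' - w" and ?du = "u' - u" and ?dv = "v' - v"
      let ?Q = "sf * (norm ?dw)\<^sup>2 + rho * (norm (A *v ?dw - ?du))\<^sup>2"
      have "lam * real (norm0 (pos_part u)) + inner z ?du
          \<le> lam * real (norm0 (pos_part u')) + 1 / (2 * alpha) * (norm ?du)\<^sup>2"
        using prox \<open>alpha > 0\<close> by (simp add: prox_fixed_point_iff_subgradient)
      with lyapunov_lower_bound_at_P_stationary[where f = f and v' = v' and u' = u', OF st fo[of w']]
      have lower: "E (w, u, v) + (?Q + mu * (norm (?dw - ?dv))\<^sup>2 - 1 / alpha * (norm ?du)\<^sup>2) / 2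
          \<le> E (w', u', v')"
        unfolding E by (simp add: right_diff_distrib add_divide_distrib diff_divide_distrib)
      have Q: "?s * (norm ?du)\<^sup>2 \<le> ?Q"
        using sigma_const_quadratic_bound \<open>sf > 0\<close> \<open>rho > 0\<close> \<open>mu > 0\<close> .
      have "0 < ?Q + mu * (norm (?dw - ?dv))\<^sup>2 - 1 / alpha * (norm ?du)\<^sup>2"
      proof (cases "u' = u")
        case False
        then have "1 / alpha * (norm ?du)\<^sup>2 < ?s * (norm ?du)\<^sup>2"
          using gap by (intro mult_strict_right_mono) auto
        moreover have "0 \<le> mu * (norm (?dw - ?dv))\<^sup>2"
          using \<open>mu > 0\<close> by simp
        ultimately show ?thesis
          using Q by linarith
      next
        case True
        \<comment> \<open>now \<open>sigma_const\<close> gives nothing, and strictness comes from the \<open>w\<close> and \<open>v\<close> blocks\<close>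
        have nn: "0 \<le> rho * (norm (A *v ?dw - ?du))\<^sup>2" "0 \<le> mu * (norm (?dw - ?dv))\<^sup>2"
          "0 \<le> sf * (norm ?dw)\<^sup>2"
          using \<open>rho > 0\<close> \<open>mu > 0\<close> \<open>sf > 0\<close> by auto
        have "0 < sf * (norm ?dw)\<^sup>2 \<or> 0 < mu * (norm (?dw - ?dv))\<^sup>2"
          using ne True \<open>mu > 0\<close> \<open>sf > 0\<close> by (cases "w' = w") auto
        with nn True show ?thesis
          by auto
      qed
      from half_gt_zero[OF this] lower show ?thesis
        by (meson less_add_same_cancel1 less_le_trans)
    qed
    then have less': "E (w, u, v) < E y" if "y \<noteq> (w, u, v)" for y
      using that by (cases y) auto
    show "unique_global_minimizer E (w, u, v)"
      unfolding unique_global_minimizer_def is_arg_min_def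
      using less' by (metis less_asym)
  qed
qed

end
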